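(* Let $m=p^k$ with $p$ prime and $k\geq 1$ an integer, and let $S\colon\mathbb{Z}_m^{(\mathbb{Z})}\to\mathbb{Z}_m^{(\mathbb{Z})}$ be a finitary linear cellular automaton. Then $$h_{alg}(S)=\deg(S)\log p^k.$$
   Context: $\mathbb{Z}_m=\mathbb{Z}/m\mathbb{Z}$; $\mathbb{Z}_m^{(\mathbb{Z})}$ is the (discrete) abelian group of finitely supported sequences $x=(x_n)_{n\in\mathbb{Z}}$ in $\mathbb{Z}_m$. A (one-dimensional) finitary linear cellular automaton on $\mathbb{Z}_m$ is a map $S=S_\lambda\colon\mathbb{Z}_m^{(\mathbb{Z})}\to\mathbb{Z}_m^{(\mathbb{Z})}$ of the form $(S_\lambda(x))_n=\sum_{i\in\mathbb{Z}}\lambda_ix_{n+i}$ for all $n\in\mathbb{Z}$, for some (unique) $\lambda\in\mathbb{Z}_m^{(\mathbb{Z})}$. Degree: let $\supp^*(\lambda)=\{i\in\mathbb{Z}:\gcd(\lambda_i,m)=1\}$, where $\supp^*$ is just the name of this set (the reduced support). If it is empty, $\deg(S_\lambda)=0$. Otherwise let $l'$ and $r'$ be its minimum and maximum and put $\deg(S_\lambda)=-l'$ if $l'\leq r'\leq 0$; $\deg(S_\lambda)=r'$ if $0\leq l'\leq r'$; $\deg(S_\lambda)=r'-l'$ if $l'<0<r'$. Algebraic entropy: for an endomorphism $\phi$ of an abelian group $G$ and a non-empty finite $F\subseteq G$, let $\mathcal{T}_n(\phi,F)=F+\phi(F)+\cdots+\phi^{n-1}(F)$ and $H_{alg}(\phi,F)=\lim_{n\to\infty}\frac{\log|\mathcal{T}_n(\phi,F)|}{n}$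 (the limit exists); then $h_{alg}(\phi)=\sup\{H_{alg}(\phi,F):F\subseteq G\text{ non-empty finite}\}$. *)

theory Defs
  imports
    "HOL-Analysis.Analysis"
    "HOL-Library.Poly_Mapping"
    "HOL-Library.Set_Algebras"
    "HOL-Library.Numeral_Type"
    "Berlekamp_Zassenhaus.Finite_Field"
begin

text \<open>
  The ring of integers modulo \<open>m\<close> is the type \<open>'a mod_ring\<close> with \<open>m = CARD('a)\<close>. Its unit element needs
  \<open>m > 1\<close>, which is the class \<open>nontriv\<close>. The two instances below make numeral types of every
  size \<open>m \<ge> 2\<close> available as indices.
\<close>

instance bit0 :: (finite) nontriv
proof
  have "CARD('a) > 0" by simp
  then show "CARD('a bit0) > 1" by (simp only: card_bit0)
qed

instance bit1 :: (finite) nontriv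
proof
  have "CARD('a) > 0" by simp
  then show "CARD('a bit1) > 1" by (simp only: card_bit1)
qed

type_synonym 'a fin_seq = "int \<Rightarrow>\<^sub>0 'a mod_ring"


section \<open>Finitary linear cellular automata\<close>

definition LCA :: "'a::nontriv fin_seq \<Rightarrow> 'a fin_seq \<Rightarrow> 'a fin_seq" where
  "LCA l x = Abs_poly_mapping
     (\<lambda>n. Sum_any (\<lambda>i. Poly_Mapping.lookup l i * Poly_Mapping.lookup x (n + i)))"

lemma lookup_LCA:
  "Poly_Mapping.lookup (LCA l x) n =
     Sum_any (\<lambda>i. Poly_Mapping.lookup l i * Poly_Mapping.lookup x (n + i))"
proof -
  let ?f = "\<lambda>n. Sum_any (\<lambda>i. Poly_Mapping.lookup l i * Poly_Mapping.lookup x (n + i))"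
  have "{n. ?f n \<noteq> 0} \<subseteq> (\<lambda>(j, i). j - i) ` (Poly_Mapping.keys x \<times> Poly_Mapping.keys l)"
  proof
    fix n assume "n \<in> {n. ?f n \<noteq> 0}"
    then have "?f n \<noteq> 0" by simp
    then obtain i where "Poly_Mapping.lookup l i * Poly_Mapping.lookup x (n + i) \<noteq> 0"
      by (rule Sum_any.not_neutral_obtains_not_neutral)
    then have "Poly_Mapping.lookup l i \<noteq> 0" "Poly_Mapping.lookup x (n + i) \<noteq> 0"
      by (metis mult_zero_left, metis mult_zero_right)
    then show "n \<in> (\<lambda>(j, i). j - i) ` (Poly_Mapping.keys x \<times> Poly_Mapping.keys l)"
      by (intro image_eqI[of _ _ "(n + i, i)"]) (auto simp: in_keys_iff)
  qed
  then have "finite {n. ?f n \<noteq> 0}"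
    by (rule finite_subset) simp
  then show ?thesis by (simp add: LCA_def)
qed

definition finitary_LCA :: "('a::nontriv fin_seq \<Rightarrow> 'a fin_seq) \<Rightarrow> bool" where
  "finitary_LCA S \<longleftrightarrow> (\<exists>l. S = LCA l)"

definition local_rule :: "('a::nontriv fin_seq \<Rightarrow> 'a fin_seq) \<Rightarrow> 'a fin_seq" where
  "local_rule S = (THE l. S = LCA l)"

lemma lookup_LCA_single:
  "Poly_Mapping.lookup (LCA l (Poly_Mapping.single 0 1)) n = Poly_Mapping.lookup l (- n)"
proof -
  have "Poly_Mapping.lookup (LCA l (Poly_Mapping.single 0 1)) n
        = Sum_any (\<lambda>i. Poly_Mapping.lookup l i * Poly_Mapping.lookup (Poly_Mapping.single 0 1) (n + i))"
    by (simp add: lookup_LCA)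
  also have "\<dots> = Sum_any (\<lambda>i. Poly_Mapping.lookup l i when i = - n)"
    by (intro arg_cong[of _ _ Sum_any] ext) (auto simp: lookup_one when_def)
  finally show ?thesis by simp
qed

lemma LCA_inject: "LCA l = LCA l' \<longleftrightarrow> l = l'"
proof
  assume "LCA l = LCA l'"
  then have "Poly_Mapping.lookup l (- n) = Poly_Mapping.lookup l' (- n)" for n
    by (metis lookup_LCA_single)
  then show "l = l'" by (metis minus_minus poly_mapping_eqI)
qed simp

lemma local_rule_LCA: "local_rule (LCA l) = l"
  by (simp add: local_rule_def LCA_inject)


section \<open>Degree\<close>

definition reduced_supp :: "'a::nontriv fin_seq \<Rightarrow> int set" where
  "reduced_supp l = {i. coprime (to_int_mod_ring (Poly_Mapping.lookup l i)) (int CARD('a))}"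

lemma finite_reduced_supp: "finite (reduced_supp l)"
proof (rule finite_subset)
  show "reduced_supp l \<subseteq> Poly_Mapping.keys l"
  proof
    fix i assume "i \<in> reduced_supp (l :: 'a fin_seq)"
    then have "Poly_Mapping.lookup l i \<noteq> 0"
      using nontriv[where 'a = 'a] by (auto simp: reduced_supp_def)
    then show "i \<in> Poly_Mapping.keys l" by (simp add: in_keys_iff)
  qed
qed simp

definition LCA_deg :: "('a::nontriv fin_seq \<Rightarrow> 'a fin_seq) \<Rightarrow> int" where
  "LCA_deg S =
    (let R = reduced_supp (local_rule S); l' = Min R; r' = Max R in
       if R = {} then 0
       else if r' \<le> 0 then - l'
       else if 0 \<le> l' then r'
       else r' - l')"


section \<open>Algebraic entropy\<close>

text \<open>The sum is the Minkowski sum of sets from \<open>HOL-Library.Set_Algebras\<close>.\<close>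

definition trajectory :: "('g::ab_group_add \<Rightarrow> 'g) \<Rightarrow> 'g set \<Rightarrow> nat \<Rightarrow> 'g set" where
  "trajectory \<phi> F n = (\<Sum>i<n. (\<phi> ^^ i) ` F)"

definition H_alg :: "('g::ab_group_add \<Rightarrow> 'g) \<Rightarrow> 'g set \<Rightarrow> real" where
  "H_alg \<phi> F = lim (\<lambda>n. ln (real (card (trajectory \<phi> F n))) / real n)"

definition h_alg :: "('g::ab_group_add \<Rightarrow> 'g) \<Rightarrow> ereal" where
  "h_alg \<phi> = (SUP F \<in> {F. finite F \<and> F \<noteq> {}}. ereal (H_alg \<phi> F))"

end

theory Submission
  imports Defs
begin

text \<open>
  Let \<open>S\<close> have local rule \<open>l\<close> over the integers modulo \<open>m = p ^ k\<close>. A coefficient of \<open>l\<close> either is a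
  unit, and then its position lies in the reduced support, or is a multiple of \<open>p\<close>. Applied to a
  configuration killed by \<open>p\<close>, the second kind contributes nothing, so there \<open>S\<close> acts through its
  \<^emph>\<open>unit part\<close> alone. If the reduced support is nonempty, the lowest cell of such a configuration
  moves at each step by exactly the maximum of the reduced support and the highest by exactly its
  minimum, since a unit times a nonzero value is nonzero. Both bounds on the entropy filter a
  configuration by the powers of \<open>p\<close> that kill it and so reduce to this case. Write \<open>L\<close> and \<open>R\<close>
  for the left and right reach of \<open>l\<close>, the number of cells by which the unit part can extend a
  support at either side; the degree is \<open>L + R\<close>.

  Upper bound. Along an orbit, \<open>k\<close> uses of the nonunit part of \<open>l\<close> already give zero, as each
  brings a factor \<open>p\<close>. Therefore \<open>n\<close> steps extend a support by at most
  \<open>n * L\<close> and \<open>n * R\<close> cells, up to a constant independent of \<open>n\<close> (\<open>keys_funpow_LCA\<close>). The \<open>n\<close>-th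
  trajectory of a finite set thus lives on \<open>n * (L + R) + O(1)\<close> cells and has at most
  \<open>m ^ (n * (L + R) + O(1))\<close> elements.

  Lower bound. Let \<open>F\<close> be the set of all configurations supported on \<open>L + R\<close> consecutive cells. In
  a relation \<open>(\<Sum>i<n. (S ^^ i) (x i)) = 0\<close> with all \<open>x i\<close> in \<open>F\<close> and killed by \<open>p\<close>, a
  nonzero last summand would have an end that sticks out of the supports of all earlier ones
  (\<open>torsion_top_summand\<close>), so all summands vanish. Multiplying by powers of \<open>p\<close> removes the
  torsion hypothesis (\<open>window_independent\<close>). The \<open>n\<close>-th trajectory of \<open>F\<close> therefore has exactly \<open>m ^ (n * (L + R))\<close>
  elements.

  The logarithms of the trajectory sizes are subadditive in \<open>n\<close>, so Fekete's lemma turns both counts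
  into statements about the limit.
\<close>

section \<open>Subadditive sequences\<close>

text \<open>
  Fekete's lemma. The limit is the infimum \<open>L\<close> of the quotients: if the quotient at \<open>q\<close> is almost
  \<open>L\<close>, cut \<open>n\<close> into blocks of length \<open>q\<close> and a remainder, whose share vanishes in the limit.
\<close>

lemma fekete_convergent:
  fixes f :: "nat \<Rightarrow> real"
  assumes nonneg: "\<And>n. 0 \<le> f n" and subadd: "\<And>m n. f (m + n) \<le> f m + f n"
  shows "convergent (\<lambda>n. f n / real n)"
proof -
  define L where "L = (INF n\<in>{1..}. f n / real n)"
  have bdd: "bdd_below ((\<lambda>n. f n / real n) ` {1..})"
    by (rule bdd_belowI[of _ 0]) (auto simp: nonneg)
  have lower: "L \<le> f n / real n" if "n \<ge> 1" for n
    unfolding L_def using that by (intro cINF_lower[OF bdd]) auto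
  have blocks: "f (s * q + r) \<le> real s * f q + f r" for s q r
  proof (induction s)
    case (Suc s)
    have "f (q + (s * q + r)) \<le> f q + f (s * q + r)" by (rule subadd)
    with Suc show ?case by (simp add: algebra_simps)
  qed simp
  have "(\<lambda>n. f n / real n) \<longlonglongrightarrow> L"
  proof (rule tendstoI)
    fix e :: real assume "e > 0"
    then have "L < L + e / 2" by simp
    then obtain q where q: "q \<ge> 1" "f q / real q < L + e / 2"
      unfolding L_def by (subst (asm) cINF_less_iff[OF _ bdd]) auto
    define B where "B = (\<Sum>r<q. f r)"
    have "(\<lambda>n. B / real n) \<longlonglongrightarrow> 0" by (rule lim_const_over_n)
    then have "\<forall>\<^sub>F n in sequentially. B / real n < e / 2"
      by (rule order_tendstoD) (use \<open>e > 0\<close> in simp)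
    then show "\<forall>\<^sub>F n in sequentially. dist (f n / real n) L < e"
      using eventually_ge_at_top[of 1]
    proof eventually_elim
      case (elim n)
      have "n mod q < q" using q by simp
      then have "f (n mod q) \<le> B"
        unfolding B_def by (intro member_le_sum) (auto simp: nonneg)
      moreover have "real (n div q) \<le> real n / real q"
        by (rule of_nat_div_le_of_nat)
      then have "real (n div q) * f q \<le> real n / real q * f q"
        by (intro mult_right_mono nonneg)
      ultimately have "f n \<le> real n * (f q / real q) + B"
        using blocks[of "n div q" q "n mod q"] by (simp add: mult.commute)
      then have "f n / real n \<le> f q / real q + B / real n"
        using elim by (simp add: field_simps)
      moreover have "f q / real q + B / real n < L + e"
        using q(2) elim(1) by linarith
      ultimately have "f n / real n < L + e" by linarith
      with lower[of n] elim(2) show ?case by (simp add: dist_real_def)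
    qed
  qed
  then show ?thesis by (rule convergentI)
qed

section \<open>Trajectories of an additive map\<close>

lemma additive_funpow:
  fixes \<phi> :: "'g::ab_group_add \<Rightarrow> 'g"
  assumes "Modules.additive \<phi>" shows "Modules.additive (\<phi> ^^ n)"
proof -
  interpret Modules.additive \<phi> by fact
  show ?thesis by (rule Modules.additive.intro, induction n) (simp_all add: add)
qed

lemma sum_in_set_sum:
  "(\<And>i. i \<in> I \<Longrightarrow> f i \<in> A i) \<Longrightarrow> sum f I \<in> sum A I"
  by (induction I rule: infinite_finite_induct) auto

lemma trajectory_eq_image:
  "trajectory \<phi> F n = (\<lambda>x. \<Sum>i<n. (\<phi> ^^ i) (x i)) ` ({..<n} \<rightarrow>\<^sub>E F)"
proof (intro equalityI subsetI)
  fix t assume "t \<in> trajectory \<phi> F n"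
  then obtain s where s: "t = sum s {..<n}" "\<forall>i<n. s i \<in> (\<phi> ^^ i) ` F"
    by (auto simp: trajectory_def set_sum_alt)
  then have "\<forall>i\<in>{..<n}. \<exists>y. y \<in> F \<and> s i = (\<phi> ^^ i) y" by auto
  then obtain y where y: "\<And>i. i < n \<Longrightarrow> y i \<in> F \<and> s i = (\<phi> ^^ i) (y i)"
    by (auto dest!: bchoice)
  have "t = (\<Sum>i<n. (\<phi> ^^ i) (restrict y {..<n} i))"
    unfolding s(1) by (rule sum.cong) (auto simp: y)
  moreover have "restrict y {..<n} \<in> {..<n} \<rightarrow>\<^sub>E F" using y by auto
  ultimately show "t \<in> (\<lambda>x. \<Sum>i<n. (\<phi> ^^ i) (x i)) ` ({..<n} \<rightarrow>\<^sub>E F)" by blast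
next
  fix t assume "t \<in> (\<lambda>x. \<Sum>i<n. (\<phi> ^^ i) (x i)) ` ({..<n} \<rightarrow>\<^sub>E F)"
  then show "t \<in> trajectory \<phi> F n"
    by (auto simp: trajectory_def set_sum_alt PiE_iff)
qed

lemma finite_trajectory: "finite F \<Longrightarrow> finite (trajectory \<phi> F n)"
  by (simp add: trajectory_eq_image finite_PiE)

lemma card_trajectory_pos:
  assumes "finite F" "F \<noteq> {}" shows "card (trajectory \<phi> F n) > 0"
  using finite_trajectory[OF assms(1)] assms(2)
  by (auto simp: card_gt_0_iff trajectory_eq_image PiE_eq_empty_iff)

text \<open>
  A trajectory of length \<open>m + n\<close> is one of length \<open>m\<close> plus the image under the additive map
  \<open>\<phi> ^^ m\<close> of one of length \<open>n\<close>.
\<close>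

lemma card_trajectory_submult:
  assumes "Modules.additive \<phi>" "finite F"
  shows "card (trajectory \<phi> F (m + n)) \<le> card (trajectory \<phi> F m) * card (trajectory \<phi> F n)"
proof -
  interpret P: Modules.additive "\<phi> ^^ m" by (rule additive_funpow) fact
  let ?T = "trajectory \<phi> F"
  have "?T (m + n) \<subseteq> (\<lambda>(s, t). s + (\<phi> ^^ m) t) ` (?T m \<times> ?T n)"
  proof
    fix t assume "t \<in> ?T (m + n)"
    then obtain x where x: "x \<in> {..<m + n} \<rightarrow>\<^sub>E F" "t = (\<Sum>i<m + n. (\<phi> ^^ i) (x i))"
      unfolding trajectory_eq_image by blast
    define y where "y = (\<Sum>i<m. (\<phi> ^^ i) (x i))"
    define z where "z = (\<Sum>i<n. (\<phi> ^^ i) (x (m + i)))"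
    have "t = y + (\<Sum>i<n. (\<phi> ^^ (m + i)) (x (m + i)))"
      unfolding x(2) y_def by (induction n) (simp_all add: add.assoc)
    then have "t = y + (\<phi> ^^ m) z"
      by (simp add: z_def P.sum funpow_add)
    moreover have "y \<in> ?T m" "z \<in> ?T n"
      unfolding y_def z_def trajectory_def using x(1)
      by (auto simp: PiE_iff intro!: sum_in_set_sum)
    ultimately show "t \<in> (\<lambda>(s, t). s + (\<phi> ^^ m) t) ` (?T m \<times> ?T n)" by auto
  qed
  then have "card (?T (m + n)) \<le> card (?T m \<times> ?T n)"
    using finite_trajectory[OF assms(2)] by (intro surj_card_le) auto
  then show ?thesis by (simp add: card_cartesian_product)
qed

text \<open>The limit that \<open>H_alg\<close> selects exists, by Fekete's lemma.\<close>

lemma H_alg_LIMSEQ: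
  assumes "Modules.additive \<phi>" "finite F" "F \<noteq> {}"
  shows "(\<lambda>n. ln (real (card (trajectory \<phi> F n))) / real n) \<longlonglongrightarrow> H_alg \<phi> F"
proof -
  let ?c = "\<lambda>n. card (trajectory \<phi> F n)"
  have pos: "?c n > 0" for n by (rule card_trajectory_pos) fact+
  have "convergent (\<lambda>n. ln (real (?c n)) / real n)"
  proof (rule fekete_convergent)
    show "0 \<le> ln (real (?c n))" for n using pos[of n] by (simp add: Suc_leI)
    fix m n
    have "ln (real (?c (m + n))) \<le> ln (real (?c m * ?c n))"
      using pos[of m] pos[of n] pos[of "m + n"] card_trajectory_submult[OF assms(1,2), of m n]
      by (subst ln_le_cancel_iff) (simp_all del: of_nat_mult)
    also have "\<dots> = ln (real (?c m)) + ln (real (?c n))"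
      using pos[of m] pos[of n] by (simp add: ln_mult)
    finally show "ln (real (?c (m + n))) \<le> ln (real (?c m)) + ln (real (?c n))" .
  qed
  then show ?thesis by (simp add: H_alg_def convergent_LIMSEQ_iff)
qed

lemma H_alg_eq_of_independent:
  assumes "Modules.additive \<phi>" "finite F" "F \<noteq> {}"
    and inj: "\<And>n. inj_on (\<lambda>x. \<Sum>i<n. (\<phi> ^^ i) (x i)) ({..<n} \<rightarrow>\<^sub>E F)"
  shows "H_alg \<phi> F = ln (real (card F))"
proof (rule LIMSEQ_unique[OF H_alg_LIMSEQ[OF assms(1-3)]])
  have "card (trajectory \<phi> F n) = card F ^ n" for n
    by (simp add: trajectory_eq_image card_image[OF inj] card_PiE)
  moreover have "card F > 0" using assms by (simp add: card_gt_0_iff)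
  ultimately have eq: "ln (real (card F)) = ln (real (card (trajectory \<phi> F n))) / real n" if "n > 0" for n
    using that by (simp add: ln_realpow)
  have "\<forall>\<^sub>F n in sequentially. ln (real (card F)) = ln (real (card (trajectory \<phi> F n))) / real n"
    using eventually_gt_at_top[of 0] by eventually_elim (rule eq)
  then show "(\<lambda>n. ln (real (card (trajectory \<phi> F n))) / real n) \<longlonglongrightarrow> ln (real (card F))"
    by (rule Lim_transform_eventually[OF tendsto_const])
qed

section \<open>Finitely supported sequences\<close>

lemma finite_card_supported_on:
  fixes A :: "'i set"
  assumes "finite A"
  shows "finite {x :: 'i \<Rightarrow>\<^sub>0 'b::{finite,zero}. Poly_Mapping.keys x \<subseteq> A}"
    and "card {x :: 'i \<Rightarrow>\<^sub>0 'b. Poly_Mapping.keys x \<subseteq> A} = CARD('b) ^ card A"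
proof -
  let ?W = "{x :: 'i \<Rightarrow>\<^sub>0 'b. Poly_Mapping.keys x \<subseteq> A}"
  have fin: "finite {i. (if i \<in> A then f i else 0) \<noteq> 0}" for f :: "'i \<Rightarrow> 'b"
    by (rule finite_subset[OF _ assms]) auto
  have "bij_betw (\<lambda>x. restrict (Poly_Mapping.lookup x) A) ?W (A \<rightarrow>\<^sub>E UNIV)"
  proof (rule bij_betw_byWitness[where f' = "\<lambda>f. Abs_poly_mapping (\<lambda>i. if i \<in> A then f i else 0)"])
    show "\<forall>x\<in>?W. Abs_poly_mapping (\<lambda>i. if i \<in> A then restrict (Poly_Mapping.lookup x) A i else 0) = x"
      by (auto intro!: poly_mapping_eqI simp: fin in_keys_iff)
    show "\<forall>f\<in>A \<rightarrow>\<^sub>E UNIV. restrict (Poly_Mapping.lookup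
        (Abs_poly_mapping (\<lambda>i. if i \<in> A then f i else 0 :: 'b))) A = f"
      by (auto simp: fin restrict_def PiE_def extensional_def)
    show "(\<lambda>f. Abs_poly_mapping (\<lambda>i. if i \<in> A then f i else 0 :: 'b)) ` (A \<rightarrow>\<^sub>E UNIV) \<subseteq> ?W"
      by (auto simp: fin in_keys_iff split: if_splits)
  qed auto
  moreover have "finite (A \<rightarrow>\<^sub>E (UNIV :: 'b set))" by (simp add: finite_PiE assms)
  ultimately show "finite ?W" "card ?W = CARD('b) ^ card A"
    by (simp_all add: bij_betw_finite bij_betw_same_card card_PiE assms)
qed

lemma lookup_of_nat_mult:
  "Poly_Mapping.lookup (of_nat q * x) n = of_nat q * Poly_Mapping.lookup (x :: 'a::nontriv fin_seq) n"
  by (induction q) (simp_all add: lookup_add distrib_right)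

lemma additive_of_nat_mult:
  fixes f :: "'a::ring_1 \<Rightarrow> 'b::ring_1"
  assumes "Modules.additive f" shows "f (of_nat q * x) = of_nat q * f x"
proof -
  interpret Modules.additive f by fact
  show ?thesis by (induction q) (simp_all add: distrib_right add zero)
qed

section \<open>Units and zero divisors\<close>

lemma of_int_to_int_mod_ring: "of_int (to_int_mod_ring c) = (c :: 'a::nontriv mod_ring)"
  by (simp add: of_int_of_int_mod_ring)

lemma mod_ring_unit_mult_eq_0:
  fixes c y :: "'a::nontriv mod_ring"
  assumes "coprime (to_int_mod_ring c) (int CARD('a))" and "c * y = 0"
  shows "y = 0"
proof -
  obtain u v where "u * to_int_mod_ring c + v * int CARD('a) = 1"
    using bezout_int[of "to_int_mod_ring c" "int CARD('a)"] assms(1) by (auto simp: coprime_iff_gcd_eq_1)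
  then have "of_int (u * to_int_mod_ring c + v * int CARD('a)) = (1 :: 'a mod_ring)" by simp
  then have "of_int u * c = 1" by (simp add: of_int_to_int_mod_ring)
  then have "y = of_int u * (c * y)" by (simp flip: mult.assoc)
  with assms(2) show ?thesis by simp
qed

lemma mod_ring_nonunit_dvd:
  fixes c :: "'a::nontriv mod_ring"
  assumes "prime p" "CARD('a) = p ^ k" and "\<not> coprime (to_int_mod_ring c) (int CARD('a))"
  shows "of_nat p dvd c"
proof -
  have "int p dvd to_int_mod_ring c"
    using assms prime_imp_coprime[of "int p" "to_int_mod_ring c"]
    by (auto simp: coprime_commute)
  then obtain t where "to_int_mod_ring c = int p * t" by (auto elim: dvdE)
  then have "c = of_int (int p * t)" by (metis of_int_to_int_mod_ring)
  then show ?thesis by simp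
qed

lemma torsion_exponent:
  fixes x :: "'a::nontriv fin_seq"
  shows "of_nat CARD('a) * x = 0"
  by (rule poly_mapping_eqI) (simp add: lookup_of_nat_mult)

section \<open>Linear cellular automata\<close>

lemma lookup_LCA_sum:
  assumes "finite A" "Poly_Mapping.keys l \<subseteq> A"
  shows "Poly_Mapping.lookup (LCA l x) n =
    (\<Sum>i\<in>A. Poly_Mapping.lookup l i * Poly_Mapping.lookup x (n + i))"
  unfolding lookup_LCA
  by (rule Sum_any.expand_superset) (use assms in \<open>auto simp: in_keys_iff subset_iff dest: mult_not_zero\<close>)

lemma additive_LCA: "Modules.additive (LCA l)"
  by unfold_locales
    (auto intro!: poly_mapping_eqI
      simp: lookup_add lookup_LCA_sum[OF _ order.refl] sum.distrib distrib_left)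

lemma LCA_add_rule: "LCA (l + l') x = LCA l x + LCA l' x"
proof (rule poly_mapping_eqI)
  fix n
  let ?A = "Poly_Mapping.keys l \<union> Poly_Mapping.keys l'"
  have "finite ?A" by simp
  then show "Poly_Mapping.lookup (LCA (l + l') x) n = Poly_Mapping.lookup (LCA l x + LCA l' x) n"
    using keys_add[of l l']
    by (simp add: lookup_LCA_sum[of ?A] lookup_add sum.distrib distrib_right)
qed

lemma in_keys_LCA_obtain:
  assumes "n \<in> Poly_Mapping.keys (LCA l x)"
  obtains i where "i \<in> Poly_Mapping.keys l" "n + i \<in> Poly_Mapping.keys x"
proof -
  from assms have "(\<Sum>i\<in>Poly_Mapping.keys l. Poly_Mapping.lookup l i * Poly_Mapping.lookup x (n + i)) \<noteq> 0"
    by (simp add: in_keys_iff lookup_LCA_sum[OF _ order.refl])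
  then obtain i where "i \<in> Poly_Mapping.keys l" "Poly_Mapping.lookup l i * Poly_Mapping.lookup x (n + i) \<noteq> 0"
    by (rule sum.not_neutral_contains_not_neutral)
  with that show ?thesis by (auto simp: in_keys_iff dest: mult_not_zero)
qed

lemma keys_LCA_subset:
  assumes "Poly_Mapping.keys l \<subseteq> {- a..b}" "Poly_Mapping.keys x \<subseteq> {lo..hi}"
  shows "Poly_Mapping.keys (LCA l x) \<subseteq> {lo - b..hi + a}"
  using assms by (force elim!: in_keys_LCA_obtain)

lemma keys_sum_subset:
  assumes "\<And>i. i \<in> I \<Longrightarrow> Poly_Mapping.keys (f i) \<subseteq> A"
  shows "Poly_Mapping.keys (sum f I) \<subseteq> A"
proof
  fix n assume "n \<in> Poly_Mapping.keys (sum f I)"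
  then have "(\<Sum>i\<in>I. Poly_Mapping.lookup (f i) n) \<noteq> 0"
    by (simp add: in_keys_iff lookup_sum)
  then obtain i where "i \<in> I" "Poly_Mapping.lookup (f i) n \<noteq> 0"
    by (rule sum.not_neutral_contains_not_neutral)
  then have "n \<in> Poly_Mapping.keys (f i)" by (simp add: in_keys_iff)
  with assms \<open>i \<in> I\<close> show "n \<in> A" by blast
qed

lemma finite_int_symmetric_bound:
  assumes "finite A" obtains N :: int where "0 \<le> N" "A \<subseteq> {- N..N}"
proof
  define N where "N = Max (insert 0 (abs ` A))"
  have "\<bar>i\<bar> \<le> N" if "i \<in> insert 0 A" for i
    unfolding N_def using that assms by (intro Max_ge) auto
  then show "0 \<le> N" "A \<subseteq> {- N..N}" by force+
qed

section \<open>The unit part of a local rule and its reach\<close>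

definition unit_part :: "'a::nontriv fin_seq \<Rightarrow> 'a fin_seq" where
  "unit_part l = Poly_Mapping.mapp (\<lambda>i c. c when i \<in> reduced_supp l) l"

lemma lookup_unit_part:
  "Poly_Mapping.lookup (unit_part l) i = (Poly_Mapping.lookup l i when i \<in> reduced_supp l)"
  by (auto simp: unit_part_def lookup_mapp when_def in_keys_iff)

lemma keys_unit_part: "Poly_Mapping.keys (unit_part l) = reduced_supp l"
proof -
  have "Poly_Mapping.lookup l i \<noteq> 0" if "i \<in> reduced_supp l" for i
    using that nontriv[where 'a = 'a] by (auto simp: reduced_supp_def)
  then show ?thesis by (auto simp: in_keys_iff lookup_unit_part when_def split: if_splits)
qed

text \<open>
  The value at \<open>n\<close> after one step depends on the values at \<open>n + i\<close>, so a positive position in the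
  rule moves content to the left, and a negative one to the right.
\<close>

definition left_reach :: "'a::nontriv fin_seq \<Rightarrow> int" where
  "left_reach l = (if reduced_supp l = {} then 0 else max 0 (Max (reduced_supp l)))"

definition right_reach :: "'a::nontriv fin_seq \<Rightarrow> int" where
  "right_reach l = (if reduced_supp l = {} then 0 else max 0 (- Min (reduced_supp l)))"

lemma reach_nonneg [simp]: "0 \<le> left_reach l" "0 \<le> right_reach l"
  by (simp_all add: left_reach_def right_reach_def)

lemma reduced_supp_subset_reach: "reduced_supp l \<subseteq> {- right_reach l..left_reach l}"
proof
  fix i assume i: "i \<in> reduced_supp l"
  then have "Min (reduced_supp l) \<le> i" "i \<le> Max (reduced_supp l)"
    using finite_reduced_supp[of l] by simp_all
  with i show "i \<in> {- right_reach l..left_reach l}"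
    by (auto simp: left_reach_def right_reach_def)
qed

lemma LCA_deg_eq_reach: "LCA_deg (LCA l) = left_reach l + right_reach l"
proof (cases "reduced_supp l = {}")
  case False
  then have "Min (reduced_supp l) \<le> Max (reduced_supp l)"
    using finite_reduced_supp[of l] by simp
  with False show ?thesis
    by (auto simp: LCA_deg_def local_rule_LCA Let_def left_reach_def right_reach_def)
qed (simp add: LCA_deg_def local_rule_LCA Let_def left_reach_def right_reach_def)

lemma keys_LCA_unit_part:
  assumes "Poly_Mapping.keys x \<subseteq> {lo..hi}"
  shows "Poly_Mapping.keys (LCA (unit_part l) x) \<subseteq> {lo - left_reach l..hi + right_reach l}"
  by (rule keys_LCA_subset[OF _ assms]) (simp add: keys_unit_part reduced_supp_subset_reach)

lemma of_nat_mult_funpow_LCA: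
  fixes x :: "'a::nontriv fin_seq"
  assumes "of_nat q * x = 0" shows "of_nat q * (LCA l ^^ n) x = 0"
proof -
  have add: "Modules.additive (LCA l ^^ n)"
    by (intro additive_funpow additive_LCA)
  show ?thesis
    using additive_of_nat_mult[OF add, of q x] Modules.additive.zero[OF add] assms by simp
qed

section \<open>Automata modulo a prime power\<close>

locale prime_power_modulus =
  fixes p k :: nat and ring :: "'a::nontriv itself"
  assumes prime_p: "prime p" and card_ring: "CARD('a) = p ^ k"
begin

lemma p_power_torsion: "of_nat (p ^ k) * (x :: 'a fin_seq) = 0"
  using torsion_exponent[of x] unfolding card_ring .

text \<open>
  The coefficients of \<open>l - unit_part l\<close> are multiples of \<open>p\<close>, so applying this rule absorbs one
  factor \<open>p\<close> from the annihilator of a configuration.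
\<close>

lemma nonunit_part_torsion:
  fixes x :: "'a fin_seq"
  assumes "of_nat (p * q) * x = 0"
  shows "of_nat q * LCA (l - unit_part l) x = 0"
proof (rule poly_mapping_eqI)
  fix n
  let ?v = "Poly_Mapping.lookup (l - unit_part l)"
  have "of_nat q * (?v i * Poly_Mapping.lookup x (n + i)) = 0" for i
  proof -
    have "of_nat p dvd ?v i"
      using mod_ring_nonunit_dvd[OF prime_p card_ring, of "Poly_Mapping.lookup l i"]
      by (auto simp: lookup_minus lookup_unit_part when_def reduced_supp_def)
    then obtain w where "?v i = of_nat p * w" by (elim dvdE)
    moreover have "of_nat (p * q) * Poly_Mapping.lookup x (n + i) = 0"
      using assms by (simp only: lookup_zero flip: lookup_of_nat_mult)
    ultimately show ?thesis by (simp add: mult_ac)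
  qed
  then show "Poly_Mapping.lookup (of_nat q * LCA (l - unit_part l) x) n = Poly_Mapping.lookup 0 n"
    by (simp add: lookup_of_nat_mult lookup_LCA_sum[OF _ order.refl] sum_distrib_left)
qed

lemma LCA_eq_unit_part:
  fixes x :: "'a fin_seq"
  assumes "of_nat p * x = 0"
  shows "LCA l x = LCA (unit_part l) x"
  using nonunit_part_torsion[of 1 x l] LCA_add_rule[of "unit_part l" "l - unit_part l" x] assms
  by simp

text \<open>
  The value in the new lowest cell is a single product: the unit at the maximum of the reduced
  support times the old lowest value.
\<close>

lemma LCA_low_end:
  fixes x :: "'a fin_seq" and l
  defines "r \<equiv> Max (reduced_supp l)"
  assumes "of_nat p * x = 0" and ne: "reduced_supp l \<noteq> {}"
    and x: "Poly_Mapping.keys x \<subseteq> {lo..}" "lo \<in> Poly_Mapping.keys x"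
  shows "Poly_Mapping.keys (LCA l x) \<subseteq> {lo - r..} \<and> lo - r \<in> Poly_Mapping.keys (LCA l x)"
proof -
  let ?u = "unit_part l" and ?R = "reduced_supp l"
  have eq: "LCA l x = LCA ?u x" by (rule LCA_eq_unit_part) fact
  have r: "r \<in> ?R" and le: "\<And>i. i \<in> ?R \<Longrightarrow> i \<le> r"
    unfolding r_def using ne finite_reduced_supp[of l] by simp_all
  have "Poly_Mapping.keys (LCA ?u x) \<subseteq> {lo - r..}"
    using x(1) le by (fastforce elim!: in_keys_LCA_obtain simp: keys_unit_part)
  moreover
  have "Poly_Mapping.lookup x (lo - r + i) = 0" if "i \<in> ?R - {r}" for i
    using that le[of i] x(1) by (force simp: in_keys_iff)
  then have "Poly_Mapping.lookup (LCA ?u x) (lo - r) = Poly_Mapping.lookup l r * Poly_Mapping.lookup x lo"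
    using r by (simp add: lookup_LCA_sum[of ?R] keys_unit_part finite_reduced_supp
        sum.remove[of ?R r] lookup_unit_part)
  then have "lo - r \<in> Poly_Mapping.keys (LCA ?u x)"
    using r x(2) mod_ring_unit_mult_eq_0[of "Poly_Mapping.lookup l r"]
    by (auto simp: in_keys_iff reduced_supp_def)
  ultimately show ?thesis by (simp add: eq)
qed

lemma LCA_high_end:
  fixes x :: "'a fin_seq" and l
  defines "r \<equiv> Min (reduced_supp l)"
  assumes "of_nat p * x = 0" and ne: "reduced_supp l \<noteq> {}"
    and x: "Poly_Mapping.keys x \<subseteq> {..hi}" "hi \<in> Poly_Mapping.keys x"
  shows "Poly_Mapping.keys (LCA l x) \<subseteq> {..hi - r} \<and> hi - r \<in> Poly_Mapping.keys (LCA l x)"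
proof -
  let ?u = "unit_part l" and ?R = "reduced_supp l"
  have eq: "LCA l x = LCA ?u x" by (rule LCA_eq_unit_part) fact
  have r: "r \<in> ?R" and le: "\<And>i. i \<in> ?R \<Longrightarrow> r \<le> i"
    unfolding r_def using ne finite_reduced_supp[of l] by simp_all
  have "Poly_Mapping.keys (LCA ?u x) \<subseteq> {..hi - r}"
    using x(1) le by (fastforce elim!: in_keys_LCA_obtain simp: keys_unit_part)
  moreover
  have "Poly_Mapping.lookup x (hi - r + i) = 0" if "i \<in> ?R - {r}" for i
    using that le[of i] x(1) by (force simp: in_keys_iff)
  then have "Poly_Mapping.lookup (LCA ?u x) (hi - r) = Poly_Mapping.lookup l r * Poly_Mapping.lookup x hi"
    using r by (simp add: lookup_LCA_sum[of ?R] keys_unit_part finite_reduced_supp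
        sum.remove[of ?R r] lookup_unit_part)
  then have "hi - r \<in> Poly_Mapping.keys (LCA ?u x)"
    using r x(2) mod_ring_unit_mult_eq_0[of "Poly_Mapping.lookup l r"]
    by (auto simp: in_keys_iff reduced_supp_def)
  ultimately show ?thesis by (simp add: eq)
qed

lemma funpow_LCA_low_end:
  fixes x :: "'a fin_seq"
  assumes "of_nat p * x = 0" "reduced_supp l \<noteq> {}"
    and "Poly_Mapping.keys x \<subseteq> {lo..}" "lo \<in> Poly_Mapping.keys x"
  defines "r \<equiv> Max (reduced_supp l)"
  shows "Poly_Mapping.keys ((LCA l ^^ n) x) \<subseteq> {lo - int n * r..} \<and>
    lo - int n * r \<in> Poly_Mapping.keys ((LCA l ^^ n) x)"
proof (induction n)
  case (Suc n)
  from LCA_low_end[OF of_nat_mult_funpow_LCA[OF assms(1)] assms(2) conjunct1[OF Suc] conjunct2[OF Suc]]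
  have "Poly_Mapping.keys (LCA l ((LCA l ^^ n) x)) \<subseteq> {lo - int n * r - r..} \<and> lo - int n * r - r
    \<in> Poly_Mapping.keys (LCA l ((LCA l ^^ n) x))"
    unfolding r_def .
  then show ?case by (simp add: algebra_simps)
qed (use assms in simp)

lemma funpow_LCA_high_end:
  fixes x :: "'a fin_seq"
  assumes "of_nat p * x = 0" "reduced_supp l \<noteq> {}"
    and "Poly_Mapping.keys x \<subseteq> {..hi}" "hi \<in> Poly_Mapping.keys x"
  defines "r \<equiv> Min (reduced_supp l)"
  shows "Poly_Mapping.keys ((LCA l ^^ n) x) \<subseteq> {..hi - int n * r} \<and>
    hi - int n * r \<in> Poly_Mapping.keys ((LCA l ^^ n) x)"
proof (induction n)
  case (Suc n)
  from LCA_high_end[OF of_nat_mult_funpow_LCA[OF assms(1)] assms(2) conjunct1[OF Suc] conjunct2[OF Suc]]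
  have "Poly_Mapping.keys (LCA l ((LCA l ^^ n) x)) \<subseteq> {..hi - int n * r - r} \<and> hi - int n * r - r
    \<in> Poly_Mapping.keys (LCA l ((LCA l ^^ n) x))"
    unfolding r_def .
  then show ?case by (simp add: algebra_simps)
qed (use assms in simp)

section \<open>Spreading of supports\<close>

text \<open>
  The step from \<open>n\<close> to \<open>n + 1\<close> splits the first application of the rule into two contributions.
  The unit part extends the support by the reach and uses up one step; the rest costs \<open>M\<close> cells but lowers the power
  \<open>j\<close> of \<open>p\<close> that kills the configuration. Hence the induction on \<open>n\<close> inside one on \<open>j\<close>.
\<close>

lemma keys_funpow_LCA:
  fixes x :: "'a fin_seq"
  assumes M: "0 \<le> M" "Poly_Mapping.keys (l - unit_part l) \<subseteq> {- M..M}"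
    and "of_nat (p ^ j) * x = 0" "Poly_Mapping.keys x \<subseteq> {lo..hi}"
  shows "Poly_Mapping.keys ((LCA l ^^ n) x) \<subseteq>
    {lo - int j * M - int n * left_reach l..hi + int j * M + int n * right_reach l}"
  using assms(3,4)
proof (induction j arbitrary: n x lo hi)
  case 0
  have "Modules.additive (LCA l ^^ n)" by (intro additive_funpow additive_LCA)
  from Modules.additive.zero[OF this] 0 show ?case by simp
next
  case (Suc j)
  note IH = Suc.IH
  from Suc.prems show ?case
  proof (induction n arbitrary: x lo hi)
    case 0
    moreover have "0 \<le> int (Suc j) * M" using M(1) by simp
    ultimately show ?case by (simp add: subset_iff) force
  next
    case (Suc n)
    interpret S: Modules.additive "LCA l ^^ n" by (intro additive_funpow additive_LCA)
    let ?U = "LCA (unit_part l) x" and ?V = "LCA (l - unit_part l) x"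
    have split: "(LCA l ^^ Suc n) x = (LCA l ^^ n) ?U + (LCA l ^^ n) ?V"
      using LCA_add_rule[of "unit_part l" "l - unit_part l" x]
      by (simp add: funpow_swap1 S.add)
    let ?W = "{lo - int (Suc j) * M - int (Suc n) * left_reach l..
       hi + int (Suc j) * M + int (Suc n) * right_reach l}"
    have "of_nat (p ^ Suc j) * ?U = 0"
      using of_nat_mult_funpow_LCA[OF Suc.prems(1), where n = 1 and l = "unit_part l"] by simp
    from Suc.IH[OF this keys_LCA_unit_part[OF Suc.prems(2)]]
    have "Poly_Mapping.keys ((LCA l ^^ n) ?U) \<subseteq> ?W"
      by (simp add: algebra_simps)
    moreover have "of_nat (p ^ j) * ?V = 0"
      using Suc.prems(1) by (intro nonunit_part_torsion) simp
    from IH[OF this keys_LCA_subset[OF M(2) Suc.prems(2)], of n]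
    have "Poly_Mapping.keys ((LCA l ^^ n) ?V) \<subseteq> ?W"
      by (rule order.trans) (auto simp: algebra_simps intro: order.trans)
    ultimately show ?case
      unfolding split by (rule order.trans[OF keys_add Un_least])
  qed
qed

lemma keys_funpow_LCA_torsion:
  fixes x :: "'a fin_seq"
  assumes "of_nat p * x = 0" "Poly_Mapping.keys x \<subseteq> {lo..hi}"
  shows "Poly_Mapping.keys ((LCA l ^^ n) x) \<subseteq>
    {lo - int n * left_reach l..hi + int n * right_reach l}"
proof (induction n)
  case (Suc n)
  from keys_LCA_unit_part[OF Suc] show ?case
    using LCA_eq_unit_part[OF of_nat_mult_funpow_LCA[OF assms(1), of n l], of l]
    by (simp add: algebra_simps)
qed (use assms in simp)

section \<open>Independence of the iterates on a window\<close>

text \<open>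
  Write \<open>L\<close> and \<open>R\<close> for the reaches. The summands with \<open>i < n\<close> all live between the cells
  \<open>L - n * L\<close> and \<open>L + n * R - 1\<close>. If the lowest cell of \<open>x n\<close> lies below \<open>L\<close>, then \<open>L\<close> is positive,
  hence equal to the maximum of the reduced support, and the lowest cell of \<open>(S ^^ n) (x n)\<close> lies
  below that interval. Otherwise the highest cell of \<open>x n\<close> lies in \<open>{L..<L + R}\<close>, so \<open>R\<close> is positive
  and the highest cell of \<open>(S ^^ n) (x n)\<close> lies above the interval.
\<close>

lemma torsion_top_summand:
  fixes x :: "nat \<Rightarrow> 'a fin_seq"
  assumes tors: "\<And>i. i \<le> n \<Longrightarrow> of_nat p * x i = 0"
    and window: "\<And>i. i \<le> n \<Longrightarrow> Poly_Mapping.keys (x i) \<subseteq> {0..<left_reach l + right_reach l}"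
    and rel: "(\<Sum>i\<le>n. (LCA l ^^ i) (x i)) = 0"
  shows "x n = 0"
proof (rule ccontr)
  let ?K = "Poly_Mapping.keys (x n)" and ?L = "left_reach l" and ?R = "right_reach l"
  assume "x n \<noteq> 0"
  then have ne: "?K \<noteq> {}" by simp
  define lo where "lo = Min ?K"
  define hi where "hi = Max ?K"
  have lo: "?K \<subseteq> {lo..}" "lo \<in> ?K" and hi: "?K \<subseteq> {..hi}" "hi \<in> ?K"
    using ne by (auto simp: lo_def hi_def)
  then have bounds: "0 \<le> lo" "lo \<le> hi" "hi < ?L + ?R"
    using window[of n] by auto
  then have R: "reduced_supp l \<noteq> {}"
    by (auto simp: left_reach_def right_reach_def)
  \<comment> \<open>Each earlier summand falls short of the last one by at least one full step of reach \<open>c\<close>.\<close>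
  have step: "int i * c \<le> int n * c - c" if "i < n" "0 \<le> c" for i c
    using mult_right_mono[of "int i" "int n - 1" c] that by (simp add: algebra_simps)
  have torsion_keys: "Poly_Mapping.keys ((LCA l ^^ i) (x i)) \<subseteq> {- (int i * ?L)..<?L + ?R + int i * ?R}"
    if "i \<le> n" for i
    using keys_funpow_LCA_torsion[OF tors[OF that], of 0 "?L + ?R - 1" i l] window[OF that] by force
  have "(\<Sum>i\<le>n. (LCA l ^^ i) (x i)) = (\<Sum>i<n. (LCA l ^^ i) (x i)) + (LCA l ^^ n) (x n)"
    by (simp add: lessThan_Suc_atMost[symmetric])
  then have "(LCA l ^^ n) (x n) = - (\<Sum>i<n. (LCA l ^^ i) (x i))"
    using rel by (simp add: eq_neg_iff_add_eq_0 add.commute)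
  then have "Poly_Mapping.keys ((LCA l ^^ n) (x n)) = Poly_Mapping.keys (\<Sum>i<n. (LCA l ^^ i) (x i))"
    by (simp add: keys_def)
  also have "\<dots> \<subseteq> {?L - int n * ?L..<?L + int n * ?R}"
  proof (rule keys_sum_subset)
    fix i assume "i \<in> {..<n}"
    then show "Poly_Mapping.keys ((LCA l ^^ i) (x i)) \<subseteq> {?L - int n * ?L..<?L + int n * ?R}"
      using torsion_keys[of i] step[of i ?L] step[of i ?R] by force
  qed
  finally have inside: "Poly_Mapping.keys ((LCA l ^^ n) (x n)) \<subseteq> {?L - int n * ?L..<?L + int n * ?R}" .
  show False
  proof (cases "lo < ?L")
    case True
    then have "?L = Max (reduced_supp l)"
      using bounds R by (auto simp: left_reach_def max_def split: if_splits)
    with funpow_LCA_low_end[OF tors[OF order.refl] R lo, of n] inside True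
    show False by auto
  next
    case False
    then have "?R = - Min (reduced_supp l)"
      using bounds R by (auto simp: right_reach_def max_def split: if_splits)
    with funpow_LCA_high_end[OF tors[OF order.refl] R hi, of n] inside False bounds
    show False by auto
  qed
qed

lemma torsion_independent:
  fixes x :: "nat \<Rightarrow> 'a fin_seq"
  assumes "\<And>i. i < n \<Longrightarrow> of_nat p * x i = 0"
    and "\<And>i. i < n \<Longrightarrow> Poly_Mapping.keys (x i) \<subseteq> {0..<left_reach l + right_reach l}"
    and "(\<Sum>i<n. (LCA l ^^ i) (x i)) = 0" and "i < n"
  shows "x i = 0"
  using assms
proof (induction n arbitrary: i)
  case (Suc n)
  have "x n = 0"
    using Suc.prems by (intro torsion_top_summand[of n x l]) (simp_all add: lessThan_Suc_atMost)
  moreover have "Modules.additive (LCA l ^^ n)" by (intro additive_funpow additive_LCA)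
  ultimately have "(\<Sum>i<n. (LCA l ^^ i) (x i)) = 0"
    using Suc.prems(3) by (simp add: Modules.additive.zero)
  then have "x j = 0" if "j < n" for j
    using Suc.IH[of j] Suc.prems(1,2) that less_SucI by blast
  with \<open>x n = 0\<close> Suc.prems(4) show ?case by (metis less_SucE)
qed simp

lemma keys_of_nat_mult: "Poly_Mapping.keys (of_nat q * (x :: 'a fin_seq)) \<subseteq> Poly_Mapping.keys x"
proof
  fix n assume "n \<in> Poly_Mapping.keys (of_nat q * x)"
  then have "of_nat q * Poly_Mapping.lookup x n \<noteq> 0"
    by (simp only: in_keys_iff lookup_of_nat_mult not_False_eq_True)
  then have "Poly_Mapping.lookup x n \<noteq> 0" using mult_not_zero by blast
  then show "n \<in> Poly_Mapping.keys x" by (simp only: in_keys_iff not_False_eq_True)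
qed

text \<open>
  If \<open>p ^ Suc j\<close> kills all \<open>x i\<close>, then the \<open>p ^ j * x i\<close> satisfy the same relation and are killed by
  \<open>p\<close>, so they vanish; thus \<open>p ^ j\<close> already kills all \<open>x i\<close>. This descends from \<open>p ^ k\<close> to \<open>1\<close>.
\<close>

lemma window_independent:
  fixes x :: "nat \<Rightarrow> 'a fin_seq"
  assumes window: "\<And>i. i < n \<Longrightarrow> Poly_Mapping.keys (x i) \<subseteq> {0..<left_reach l + right_reach l}"
    and rel: "(\<Sum>i<n. (LCA l ^^ i) (x i)) = 0" and "i < n"
  shows "x i = 0"
proof -
  have "\<forall>i<n. x i = 0" if "\<forall>i<n. of_nat (p ^ j) * x i = 0" for j
    using that
  proof (induction j)
    case (Suc j)
    define y where "y i = of_nat (p ^ j) * x i" for i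
    have "(\<Sum>i<n. (LCA l ^^ i) (y i)) = of_nat (p ^ j) * (\<Sum>i<n. (LCA l ^^ i) (x i))"
      unfolding y_def sum_distrib_left
      by (intro sum.cong refl additive_of_nat_mult additive_funpow additive_LCA)
    then have "(\<Sum>i<n. (LCA l ^^ i) (y i)) = 0" by (simp add: rel)
    moreover have "of_nat p * y i = 0" if "i < n" for i
      using Suc.prems that by (simp add: y_def mult.assoc)
    moreover have "Poly_Mapping.keys (y i) \<subseteq> {0..<left_reach l + right_reach l}" if "i < n" for i
      unfolding y_def using keys_of_nat_mult window[OF that] by (rule order.trans)
    ultimately have "\<forall>i<n. y i = 0"
      using torsion_independent[of n y l] by blast
    then show ?case unfolding y_def by (rule Suc.IH)
  qed simp
  from this[of k] show ?thesis using p_power_torsion \<open>i < n\<close> by blast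
qed

section \<open>Entropy\<close>

lemma H_alg_window:
  "H_alg (LCA l) {x :: 'a fin_seq. Poly_Mapping.keys x \<subseteq> {0..<left_reach l + right_reach l}} =
    real_of_int (left_reach l + right_reach l) * ln (real CARD('a))"
proof -
  let ?D = "{0..<left_reach l + right_reach l}"
  let ?F = "{x :: 'a fin_seq. Poly_Mapping.keys x \<subseteq> ?D}"
  have "H_alg (LCA l) ?F = ln (real (card ?F))"
  proof (rule H_alg_eq_of_independent)
    show "Modules.additive (LCA l)" by (rule additive_LCA)
    show "finite ?F" by (rule finite_card_supported_on) simp
    show "?F \<noteq> {}" by (auto intro!: exI[of _ 0])
    show "inj_on (\<lambda>x. \<Sum>i<n. (LCA l ^^ i) (x i)) ({..<n} \<rightarrow>\<^sub>E ?F)" for n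
    proof (rule inj_onI)
      fix x y assume x: "x \<in> {..<n} \<rightarrow>\<^sub>E ?F" and y: "y \<in> {..<n} \<rightarrow>\<^sub>E ?F"
        and eq: "(\<Sum>i<n. (LCA l ^^ i) (x i)) = (\<Sum>i<n. (LCA l ^^ i) (y i))"
      have "(LCA l ^^ i) (x i - y i) = (LCA l ^^ i) (x i) - (LCA l ^^ i) (y i)" for i
        by (intro Modules.additive.diff additive_funpow additive_LCA)
      then have rel: "(\<Sum>i<n. (LCA l ^^ i) (x i - y i)) = 0"
        using eq by (simp add: sum_subtractf)
      have "Poly_Mapping.keys (x i - y i) \<subseteq> ?D" if "i < n" for i
      proof -
        have "Poly_Mapping.keys (x i) \<subseteq> ?D" "Poly_Mapping.keys (y i) \<subseteq> ?D"
          using x y that by auto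
        then show ?thesis using keys_diff[of "x i" "y i"] by blast
      qed
      with rel have "x i - y i = 0" if "i < n" for i
        using window_independent[of n "\<lambda>i. x i - y i" l i] that by blast
      then show "x = y"
        using x y by (intro PiE_ext) auto
    qed
  qed
  also have "card ?F = CARD('a) ^ card ?D" by (simp add: finite_card_supported_on)
  also have "ln (real \<dots>) = real_of_int (left_reach l + right_reach l) * ln (real CARD('a))"
    by (simp add: ln_realpow)
  finally show ?thesis .
qed

lemma card_trajectory_bound:
  fixes F :: "'a fin_seq set"
  assumes "finite F"
  obtains C where "\<And>n. card (trajectory (LCA l) F n)
    \<le> CARD('a) ^ (n * nat (left_reach l + right_reach l) + C)"
proof -
  let ?L = "left_reach l" and ?R = "right_reach l"
  obtain M where M: "0 \<le> M" "Poly_Mapping.keys (l - unit_part l) \<subseteq> {- M..M}"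
    by (rule finite_int_symmetric_bound[OF finite_keys])
  obtain N where N: "0 \<le> N" "(\<Union>x\<in>F. Poly_Mapping.keys x) \<subseteq> {- N..N}"
    by (rule finite_int_symmetric_bound[of "\<Union>x\<in>F. Poly_Mapping.keys x"]) (use assms in simp)
  \<comment> \<open>\<open>N\<close> covers the supports in \<open>F\<close>, and \<open>k * M\<close> all uses of the nonunit part along an orbit.\<close>
  define B where "B = N + int k * M"
  have "0 \<le> B" using M N by (simp add: B_def)
  have "card (trajectory (LCA l) F n) \<le> CARD('a) ^ (n * nat (?L + ?R) + nat (2 * B + 1))" for n
  proof -
    let ?W = "{- B - int n * ?L..B + int n * ?R}"
    have "trajectory (LCA l) F n \<subseteq> {x. Poly_Mapping.keys x \<subseteq> ?W}"
      unfolding trajectory_eq_image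
    proof (intro image_subsetI CollectI keys_sum_subset)
      fix x i assume "x \<in> {..<n} \<rightarrow>\<^sub>E F" "i \<in> {..<n}"
      then have "x i \<in> F" by auto
      then have "Poly_Mapping.keys (x i) \<subseteq> {- N..N}" using N by auto
      moreover have "of_nat (p ^ k) * x i = 0"
        by (rule p_power_torsion)
      ultimately have "Poly_Mapping.keys ((LCA l ^^ i) (x i))
          \<subseteq> {- N - int k * M - int i * ?L..N + int k * M + int i * ?R}"
        using M by (intro keys_funpow_LCA) auto
      moreover have "int i * ?L \<le> int n * ?L" "int i * ?R \<le> int n * ?R"
        using \<open>i \<in> {..<n}\<close> by (auto intro!: mult_right_mono)
      ultimately show "Poly_Mapping.keys ((LCA l ^^ i) (x i)) \<subseteq> ?W"
        by (force simp: B_def)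
    qed
    then have "card (trajectory (LCA l) F n) \<le> card {x :: 'a fin_seq. Poly_Mapping.keys x \<subseteq> ?W}"
      by (intro card_mono finite_card_supported_on) auto
    also have "\<dots> = CARD('a) ^ nat (int n * (?L + ?R) + (2 * B + 1))"
      by (simp add: finite_card_supported_on algebra_simps)
    also have "nat (int n * (?L + ?R) + (2 * B + 1)) = n * nat (?L + ?R) + nat (2 * B + 1)"
      using \<open>0 \<le> B\<close> by (subst nat_add_distrib) (simp_all add: nat_mult_distrib)
    finally show ?thesis .
  qed
  then show thesis by (rule that)
qed

lemma H_alg_le:
  fixes F :: "'a fin_seq set"
  assumes "finite F" "F \<noteq> {}"
  shows "H_alg (LCA l) F \<le> real_of_int (left_reach l + right_reach l) * ln (real CARD('a))"
proof -
  define d where "d = nat (left_reach l + right_reach l)"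
  obtain C where C: "\<And>n. card (trajectory (LCA l) F n) \<le> CARD('a) ^ (n * d + C)"
    unfolding d_def using card_trajectory_bound[OF assms(1), of l] by blast
  define c where "c = ln (real CARD('a))"
  have "(\<lambda>n. (real d + real C / real n) * c) \<longlonglongrightarrow> (real d + 0) * c"
    by (intro tendsto_intros lim_const_over_n)
  then have "H_alg (LCA l) F \<le> (real d + 0) * c"
  proof (rule LIMSEQ_le[OF H_alg_LIMSEQ[OF additive_LCA assms]], intro exI allI impI)
    fix n :: nat assume n: "1 \<le> n"
    let ?t = "card (trajectory (LCA l) F n)"
    have "?t > 0" by (rule card_trajectory_pos) fact+
    then have "ln (real ?t) \<le> ln (real (CARD('a) ^ (n * d + C)))"
      using C[of n] by (subst ln_le_cancel_iff) (simp_all del: of_nat_power)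
    also have "\<dots> = (real n * real d + real C) * c"
      by (simp add: c_def ln_realpow)
    finally show "ln (real ?t) / real n \<le> (real d + real C / real n) * c"
      using n by (simp add: field_simps)
  qed
  then show ?thesis by (simp add: c_def d_def)
qed

end

theorem theorem1p11:
  fixes p k :: nat
    and S :: "'a::nontriv fin_seq \<Rightarrow> 'a fin_seq"
  assumes "prime p" and "k \<ge> 1" and "CARD('a) = p ^ k"
    and "finitary_LCA S"
  shows "h_alg S = ereal (real_of_int (LCA_deg S) * ln (real (p ^ k)))"
proof -
  interpret prime_power_modulus p k "TYPE('a)" by unfold_locales fact+
  obtain l where S: "S = LCA l" using assms(4) by (auto simp: finitary_LCA_def)
  define F where "F = {x :: 'a fin_seq. Poly_Mapping.keys x \<subseteq> {0..<left_reach l + right_reach l}}"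
  have "finite F" unfolding F_def by (rule finite_card_supported_on) simp
  moreover have "F \<noteq> {}" unfolding F_def by (auto intro!: exI[of _ 0])
  moreover have "ereal (H_alg S F) = ereal (real_of_int (LCA_deg S) * ln (real (p ^ k)))"
    unfolding F_def S by (simp only: H_alg_window LCA_deg_eq_reach card_ring)
  moreover have "H_alg S F' \<le> real_of_int (LCA_deg S) * ln (real (p ^ k))"
    if "finite F'" "F' \<noteq> {}" for F'
    using H_alg_le[OF that, of l] by (simp only: S LCA_deg_eq_reach card_ring)
  ultimately show ?thesis
    unfolding h_alg_def by (intro antisym SUP_least) (auto intro: SUP_upper2[of F])
qed

end
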